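(* Let $0<\omega<\infty$, $C\in\mathbb{C}$, and let $\alpha\in\mathbb{C}$ with $\Re\alpha=0$, $\alpha\neq 0$. Then the operator $A_\alpha=V_\alpha^{-1}QV_\alpha$ on $L^2(0,\omega)$ has the form $$A_\alpha f=xf(x)+\alpha\int_0^x (x-y)E_0(x-y)f(y)\,dy,\qquad f\in L^2(0,\omega),$$ where $$E_0(x)=\int_0^\infty \frac{1}{\Gamma(s)}e^{-Cs}s^{-1}x^{s-1}\,ds .$$
   Context: $\Gamma$ is Euler's gamma function. $Q$ is multiplication by the independent variable on $L^2(0,\omega)$: $(Qf)(x)=xf(x)$. For $\Re\beta>0$, $V_\beta$ is the bounded operator on $L^2(0,\omega)$ $$(V_\beta f)(x)=\frac{1}{\Gamma(\beta)}\int_0^x E_\beta(x-t)f(t)\,dt,\qquad E_\beta(x)=\int_0^\infty\frac{1}{\Gamma(s)}e^{-Cs}s^{\beta-1}x^{s-1}\,ds,$$ with a fixed $C\in\mathbb{C}$. For $\Re\alpha=0$, $V_\alpha$ denotes the bounded operator on $L^2(0,\omega)$ which is the strong limit of $V_{\alpha+\nu}$ as $\nu\to+0$, and $V_\alpha^{-1}$ is its bounded inverse (namely $V_{-\alpha}$). *)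

theory Defs
  imports "HOL-Analysis.Analysis"
begin

text \<open>
  Elements of $L^2(0,\omega)$ are represented by Borel functions on the interval (every class
  has a Borel representative) and compared almost everywhere. Operators act on representatives;
  for a bounded linear operator in the sense below, linearity and boundedness force
  almost everywhere equal arguments to have almost everywhere equal images.
\<close>

abbreviation interval_lborel :: "real \<Rightarrow> real measure" where
  "interval_lborel \<omega> \<equiv> restrict_space lborel {0<..<\<omega>}"

definition L2 :: "real \<Rightarrow> (real \<Rightarrow> complex) set" where
  "L2 \<omega> = {f \<in> borel_measurable (interval_lborel \<omega>).
            integrable (interval_lborel \<omega>) (\<lambda>x. (norm (f x))\<^sup>2)}"

definition L2_norm :: "real \<Rightarrow> (real \<Rightarrow> complex) \<Rightarrow> real" where
  "L2_norm \<omega> f = sqrt (LINT x|interval_lborel \<omega>. (norm (f x))\<^sup>2)"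

definition L2_eq :: "real \<Rightarrow> (real \<Rightarrow> complex) \<Rightarrow> (real \<Rightarrow> complex) \<Rightarrow> bool" where
  "L2_eq \<omega> f g \<longleftrightarrow> (AE x in interval_lborel \<omega>. f x = g x)"

type_synonym operator = "(real \<Rightarrow> complex) \<Rightarrow> (real \<Rightarrow> complex)"

definition bounded_operator :: "real \<Rightarrow> operator \<Rightarrow> bool" where
  "bounded_operator \<omega> T \<longleftrightarrow>
     (\<forall>f\<in>L2 \<omega>. T f \<in> L2 \<omega>) \<and>
     (\<forall>f\<in>L2 \<omega>. \<forall>g\<in>L2 \<omega>. L2_eq \<omega> (T (\<lambda>x. f x + g x)) (\<lambda>x. T f x + T g x)) \<and>
     (\<forall>c. \<forall>f\<in>L2 \<omega>. L2_eq \<omega> (T (\<lambda>x. c * f x)) (\<lambda>x. c * T f x)) \<and>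
     (\<exists>K. \<forall>f\<in>L2 \<omega>. L2_norm \<omega> (T f) \<le> K * L2_norm \<omega> f)"

definition bounded_inverse :: "real \<Rightarrow> operator \<Rightarrow> operator \<Rightarrow> bool" where
  "bounded_inverse \<omega> T S \<longleftrightarrow>
     bounded_operator \<omega> S \<and>
     (\<forall>f\<in>L2 \<omega>. L2_eq \<omega> (S (T f)) f \<and> L2_eq \<omega> (T (S f)) f)"

text \<open>
  The membership condition is needed because the Bochner integral in \<open>L2_norm\<close> is \<open>0\<close> for
  functions that are not square integrable.
\<close>

definition strong_limit :: "real \<Rightarrow> ('i \<Rightarrow> operator) \<Rightarrow> operator \<Rightarrow> 'i filter \<Rightarrow> bool" where
  "strong_limit \<omega> T S F \<longleftrightarrow>
     (\<forall>f\<in>L2 \<omega>. S f \<in> L2 \<omega> \<and> (\<forall>\<^sub>F i in F. T i f \<in> L2 \<omega>) \<and>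
        ((\<lambda>i. L2_norm \<omega> (\<lambda>x. T i f x - S f x)) \<longlongrightarrow> 0) F)"

definition Q :: operator where
  "Q f = (\<lambda>x. of_real x * f x)"

definition E :: "complex \<Rightarrow> complex \<Rightarrow> real \<Rightarrow> complex" where
  "E C \<beta> x = (LINT s:{0<..}|lborel.
     1 / Gamma (of_real s) * exp (- C * of_real s)
       * of_real s powr (\<beta> - 1) * of_real (x powr (s - 1)))"

text \<open>The operator \<open>V\<^sub>\<beta>\<close> for $\Re\beta > 0$.\<close>

definition V :: "complex \<Rightarrow> complex \<Rightarrow> operator" where
  "V C \<beta> f = (\<lambda>x. 1 / Gamma \<beta> * (LINT t:{0<..<x}|lborel. E C \<beta> (x - t) * f t))"

text \<open>\<open>V\<^sub>\<alpha>\<close> for $\Re\alpha = 0$, determined up to almost everywhere equality.\<close>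

definition is_V_imag :: "real \<Rightarrow> complex \<Rightarrow> complex \<Rightarrow> operator \<Rightarrow> bool" where
  "is_V_imag \<omega> C \<alpha> T \<longleftrightarrow>
     bounded_operator \<omega> T \<and>
     strong_limit \<omega> (\<lambda>\<nu>. V C (\<alpha> + of_real \<nu>)) T (at_right 0)"

end

theory Submission
  imports Defs
begin

text \<open>
  Since $x^{s-1}/\Gamma(s)$ is a convolution semigroup in $s$, for $\Re\beta>0$ the convolution of
  $E_\beta$ with $xE_0(x)=\int_0^\infty e^{-Cr}x^r/\Gamma(r+1)\,dr$ is
  $\int_0^\infty e^{-Cu}\frac{x^u}{\Gamma(u+1)}\int_0^u s^{\beta-1}\,ds\,du = xE_\beta(x)/\beta$.
  Writing $K$ for convolution with $xE_0(x)$, this says $QV_\beta-V_\beta Q=\beta V_\beta K$.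
  Letting $\beta=\alpha+\nu$ with $\nu\to+0$ in the strong sense gives the same identity for
  $V_\alpha$, and applying $V_\alpha^{-1}$ yields $A_\alpha=Q+\alpha K$.
\<close>

section \<open>Fubini on sets, and integrals of powers against the reciprocal Gamma function\<close>

text \<open>Near 0 the kernel E_0 behaves like 1 / (x |ln x|) and is not integrable, while x E_0(x)
  is bounded on (0, \<omega>]; so K, and never convolution with E_0 itself, is the operator to
  handle. For Re \<alpha> = 0 the kernel E_\<alpha> has the same non-integrable size, so there is no
  absolutely convergent integral for V_\<alpha>, and all work with kernels has to be done at Re
  \<beta> > 0. The integrals over s converge for every C and x because 1 / \<Gamma>(s) decays faster
  than any exponential; near s = 0 convergence is governed by the power s^(\<beta> - 1) alone, and
  this is where Re \<beta> > 0 enters. Even then E_\<beta> is integrable but not square integrable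
  near 0. The integral defining V_\<beta> f(x) can therefore be expected to converge only for almost
  every x, and the identity between operators is an identity almost everywhere.\<close>

lemma set_Fubini:
  fixes F :: "real \<Rightarrow> real \<Rightarrow> 'a::{banach, second_countable_topology}"
  assumes F[measurable]: "case_prod F \<in> borel_measurable (lborel \<Otimes>\<^sub>M lborel)"
    and A[measurable]: "A \<in> sets borel" and B[measurable]: "B \<in> sets borel"
    and I: "\<And>s. s \<in> A \<Longrightarrow> set_integrable lborel B (F s)"
    and N: "\<And>s. s \<in> A \<Longrightarrow> (LINT t:B|lborel. norm (F s t)) \<le> G s"
    and G: "set_integrable lborel A G"
  shows "(LINT s:A|lborel. LINT t:B|lborel. F s t) = (LINT t:B|lborel. LINT s:A|lborel. F s t)"
    and "AE t in lborel. t \<in> B \<longrightarrow> set_integrable lborel A (\<lambda>s. F s t)"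
    and "set_integrable lborel B (\<lambda>t. LINT s:A|lborel. F s t)"
proof -
  \<comment> \<open>Extension by zero moves the problem from A x B to the plane. The bound G on the
    inner integrals of the norm is exactly what Tonelli asks for, in one order of
    integration.\<close>
  let ?H = "\<lambda>s t. indicat_real A s *\<^sub>R indicat_real B t *\<^sub>R F s t"
  have int: "integrable (lborel \<Otimes>\<^sub>M lborel) (case_prod ?H)"
  proof (rule lborel_pair.Fubini_integrable)
    show "integrable lborel (\<lambda>x. \<integral>y. norm (case_prod ?H (x, y)) \<partial>lborel)"
    proof (rule Bochner_Integration.integrable_bound)
      show "integrable lborel (\<lambda>x. indicat_real A x *\<^sub>R G x)"
        using G by (simp add: set_integrable_def)
      show "AE x in lborel. norm (\<integral>y. norm (case_prod ?H (x, y)) \<partial>lborel)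
              \<le> norm (indicat_real A x *\<^sub>R G x)"
      proof (rule AE_I2)
        fix x
        show "norm (\<integral>y. norm (case_prod ?H (x, y)) \<partial>lborel) \<le> norm (indicat_real A x *\<^sub>R G x)"
        proof (cases "x \<in> A")
          case True
          then have "(\<integral>y. norm (case_prod ?H (x, y)) \<partial>lborel) = (LINT t:B|lborel. norm (F x t))"
            by (simp add: set_lebesgue_integral_def)
          moreover have "(\<integral>y. norm (case_prod ?H (x, y)) \<partial>lborel) \<ge> 0"
            by (rule Bochner_Integration.integral_nonneg) simp
          ultimately show ?thesis
            using N[OF True] True by simp
        qed simp
      qed
    qed measurable
    show "AE x in lborel. integrable lborel (\<lambda>y. case_prod ?H (x, y))"
    proof (rule AE_I2)
      show "integrable lborel (\<lambda>y. case_prod ?H (x, y))" for x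
        using I[of x] by (cases "x \<in> A") (auto simp: set_integrable_def)
    qed
  qed measurable
  show "(LINT s:A|lborel. LINT t:B|lborel. F s t) = (LINT t:B|lborel. LINT s:A|lborel. F s t)"
    using lborel_pair.Fubini_integral[OF int]
    by (simp add: set_lebesgue_integral_def scaleR_left_commute[of "indicat_real A _"]
            mult.commute[of "indicat_real B _"]
          flip: integral_scaleR_right)
  show "AE t in lborel. t \<in> B \<longrightarrow> set_integrable lborel A (\<lambda>s. F s t)"
    using lborel_pair.AE_integrable_snd[OF int]
    by eventually_elim (auto simp: set_integrable_def)
  show "set_integrable lborel B (\<lambda>t. LINT s:A|lborel. F s t)"
    using lborel_pair.integrable_snd[OF int]
    by (simp add: set_lebesgue_integral_def set_integrable_def scaleR_left_commute[of "indicat_real A _"]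
          mult.commute[of "indicat_real B _"]
          flip: integral_scaleR_right)
qed

text \<open>In Euler's integral for \<Gamma>(s + 1) only the piece over [P, P + 1] with P = e^L is
  kept; there t^s \<ge> e^(L s) and e^(-t) \<ge> e^(-(P + 1)). Since L is arbitrary, the decay beats
  every exponential.\<close>

lemma rGamma_le_exp:
  fixes L :: real
  obtains K where "\<And>s. s \<ge> 0 \<Longrightarrow> rGamma (s + 1) \<le> K * exp (- (L * s))"
proof
  fix s :: real
  assume s: "s \<ge> 0"
  define P where "P = exp L"
  have P: "P > 0" by (simp add: P_def)
  let ?f = "\<lambda>t::real. t powr s / exp t"
  have G: "(?f has_integral Gamma (s + 1)) {0..}"
    using Gamma_integral_real[of "s + 1"] s by simp
  have f: "?f integrable_on {P..P + 1}"
    using P by (intro integrable_continuous_real continuous_intros) auto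
  then have 1: "integral {P..P + 1} ?f \<le> Gamma (s + 1)"
    using P by (intro has_integral_subset_le[OF _ integrable_integral[OF f] G]) auto
  have "integral {P..P + 1} (\<lambda>_. P powr s / exp (P + 1)) \<le> integral {P..P + 1} ?f"
  proof (rule integral_le[OF _ f])
    show "P powr s / exp (P + 1) \<le> t powr s / exp t" if "t \<in> {P..P + 1}" for t
      using that P s by (intro frac_le powr_mono2) auto
  qed auto
  then have "P powr s / exp (P + 1) \<le> Gamma (s + 1)"
    using 1 by simp
  moreover have "P powr s / exp (P + 1) > 0" using P by simp
  ultimately have "inverse (Gamma (s + 1)) \<le> inverse (P powr s / exp (P + 1))"
    by (rule le_imp_inverse_le)
  then show "rGamma (s + 1) \<le> exp (exp L + 1) * exp (- (L * s))"
    using P by (simp add: rGamma_inverse_Gamma P_def powr_def exp_minus field_simps)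
qed

lemma rGamma_real_nonneg: "0 \<le> rGamma (s + 1)" if "s \<ge> 0" for s :: real
  using that by (simp add: rGamma_inverse_Gamma Gamma_real_nonneg)

lemma borel_measurable_rGamma [measurable]:
  "(rGamma :: 'a::Gamma \<Rightarrow> 'a) \<in> borel_measurable borel"
  by (intro borel_measurable_continuous_onI continuous_intros)

text \<open>The principal branch has its cut along the negative reals, so continuity does not cover
  the whole line. Splitting by the sign of s leaves only real logarithms and a constant
  argument.\<close>

lemma borel_measurable_complex_powr [measurable]:
  assumes "f \<in> borel_measurable M"
  shows "(\<lambda>s. complex_of_real (f s) powr \<beta>) \<in> borel_measurable M"
proof -
  have "(\<lambda>s. complex_of_real s powr \<beta>) =
     (\<lambda>s. if s = 0 then 0 else exp (\<beta> * (if s > 0 then of_real (ln s) else of_real (ln (- s)) + \<i> * pi)))"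
    by (auto simp: powr_def Ln_of_real Ln_of_real' fun_eq_iff intro!: arg_cong[of _ _ exp])
  also have "\<dots> \<in> borel_measurable borel" by measurable
  finally show ?thesis using assms by (rule measurable_compose_rev)
qed

text \<open>The basic dominating function for integrals over s: the power controls s near 0, and
  both e^(-C s) and x^s are absorbed into e^(L s) by taking L = ln x - Re C.\<close>

lemma set_integrable_rGamma_weight:
  fixes b L :: real
  assumes "b > 0"
  shows "set_integrable lborel {0<..} (\<lambda>s. rGamma (s + 1) * s powr (b - 1) * exp (L * s))"
proof -
  \<comment> \<open>Decay at rate L + 1 cancels e^(L s) and leaves e^(-s), so that the integrand of
    \<Gamma>(b) dominates.\<close>
  obtain K where K: "\<And>s. s \<ge> 0 \<Longrightarrow> rGamma (s + 1) \<le> K * exp (- ((L + 1) * s))"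
    using rGamma_le_exp[of "L + 1"] by blast
  have "(\<lambda>t. complex_of_real t powr (b - 1) / of_real (exp t)) absolutely_integrable_on {0<..}"
    using absolutely_integrable_Gamma_integral'[of b] assms by simp
  \<comment> \<open>Absolute integrability refers to the completed Lebesgue measure; for a Borel
    function it is the same as integrability with respect to \<open>lborel\<close>.\<close>
  then have "integrable lborel (\<lambda>t. indicat_real {0<..} t *\<^sub>R (complex_of_real t powr (b - 1) / of_real (exp t)))"
    unfolding set_integrable_def by (subst (asm) integrable_completion) auto
  then have G: "set_integrable lborel {0<..} (\<lambda>t. K *\<^sub>R (complex_of_real t powr (b - 1) / of_real (exp t)))"
    by (intro set_integrable_scaleR_right) (simp add: set_integrable_def)
  show ?thesis
  proof (rule set_integrable_bound[OF G])
    show "AE s in lborel. s \<in> {0<..} \<longrightarrow> norm (rGamma (s + 1) * s powr (b - 1) * exp (L * s))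
       \<le> norm (K *\<^sub>R (complex_of_real s powr (b - 1) / of_real (exp s)))"
    proof (intro AE_I2 impI)
      fix s :: real assume s: "s \<in> {0<..}"
      then have "rGamma (s + 1) * (s powr (b - 1) * exp (L * s))
           \<le> (K * exp (- ((L + 1) * s))) * (s powr (b - 1) * exp (L * s))"
        by (intro mult_right_mono K) auto
      also have "\<dots> = K * (s powr (b - 1) * (exp (- ((L + 1) * s)) * exp (L * s)))"
        by (simp only: mult_ac)
      also have "exp (- ((L + 1) * s)) * exp (L * s) = exp (- s)"
        by (simp add: algebra_simps flip: exp_add)
      also have "s powr (b - 1) * exp (- s) = s powr (b - 1) / exp s"
        by (simp add: exp_minus field_simps)
      also have "K * (s powr (b - 1) / exp s) \<le> \<bar>K\<bar> * (s powr (b - 1) / exp s)"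
        using mult_right_mono[OF abs_ge_self, of "s powr (b - 1) / exp s" K] by simp
      finally show "norm (rGamma (s + 1) * s powr (b - 1) * exp (L * s))
         \<le> norm (K *\<^sub>R (complex_of_real s powr (b - 1) / of_real (exp s)))"
        using s rGamma_real_nonneg[of s]
        by (simp add: norm_divide norm_powr_real_powr abs_mult mult_ac)
    qed
  qed (simp add: set_borel_measurable_def)
qed

text \<open>Scaling reduces this to Euler's Beta integral on [0, 1]. With B(a, b) = \<Gamma>(a)
  \<Gamma>(b) / \<Gamma>(a + b) it is the semigroup law of x^(a - 1) / \<Gamma>(a).\<close>

lemma
  fixes a b x :: real
  assumes "a > 0" "b > 0" "x > 0"
  shows set_integrable_Beta_scaled:
      "set_integrable lborel {0<..<x} (\<lambda>t. (x - t) powr (a - 1) * t powr (b - 1))"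
    and set_integral_Beta_scaled:
      "(LINT t:{0<..<x}|lborel. (x - t) powr (a - 1) * t powr (b - 1)) = x powr (a + b - 1) * Beta a b"
proof -
  let ?g = "\<lambda>t. indicat_real {0<..<x} t *\<^sub>R ((x - t) powr (a - 1) * t powr (b - 1))"
  let ?h = "\<lambda>t::real. t powr (b - 1) * (1 - t) powr (a - 1)"
  \<comment> \<open>The left side has the shape of the affine substitution rule. Open and closed
    intervals agree pointwise because \<open>0 powr r = 0\<close> makes the Beta integrand vanish at
    both ends.\<close>
  have eq: "?g (0 + x * t) = x powr (a + b - 2) * (indicat_real {0..1} t *\<^sub>R ?h t)"
    for t
  proof -
    have "(x - x * t) powr (a - 1) * (x * t) powr (b - 1) =
      x powr (a + b - 2) * (t powr (b - 1) * (1 - t) powr (a - 1))" if "0 < t" "t < 1"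
    proof -
      have "x - x * t = x * (1 - t)" by (simp add: algebra_simps)
      moreover have "x powr (a + b - 2) = x powr (a - 1) * x powr (b - 1)"
        by (simp flip: powr_add)
      ultimately show ?thesis using that assms by (simp add: powr_mult)
    qed
    then show ?thesis
      using assms by (cases "t = 0 \<or> t = 1") (auto simp: indicator_def zero_less_mult_iff)
  qed
  have int: "set_integrable lborel {0..1} ?h"
    by (rule integrable_Beta) (use assms in auto)
  then have "integrable lborel (\<lambda>t. ?g (0 + x * t))"
    unfolding eq set_integrable_def by (rule integrable_mult_right)
  then show "set_integrable lborel {0<..<x} (\<lambda>t. (x - t) powr (a - 1) * t powr (b - 1))"
    unfolding set_integrable_def using assms by (subst (asm) lborel_integrable_real_affine_iff) auto
  have "(LINT t:{0..1}|lborel. ?h t) = Beta b a"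
    using set_borel_integral_eq_integral(2)[OF int] has_integral_Beta_real[of b a] assms
    by (simp add: integral_unique)
  then have h: "(\<integral>t. indicat_real {0..1} t *\<^sub>R ?h t \<partial>lborel) = Beta a b"
    by (simp add: set_lebesgue_integral_def Beta_commute)
  have "(LINT t:{0<..<x}|lborel. (x - t) powr (a - 1) * t powr (b - 1)) = x * (\<integral>t. ?g (0 + x * t) \<partial>lborel)"
    unfolding set_lebesgue_integral_def
    using assms by (subst lborel_integral_real_affine[where c = x and t = 0]) auto
  also have "\<dots> = x * x powr (a + b - 2) * Beta a b"
    unfolding eq integral_mult_right_zero h by simp
  also have "x * x powr (a + b - 2) = x powr (1 + (a + b - 2))"
    using assms by (subst powr_add) simp
  finally show "(LINT t:{0<..<x}|lborel. (x - t) powr (a - 1) * t powr (b - 1)) = x powr (a + b - 1) * Beta a b"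
    by (simp add: algebra_simps)
qed

text \<open>The improper power integrals are the Beta integrals with one parameter equal to 1, as
  B(a, 1) = 1 / a.\<close>

lemma
  fixes a x :: real
  assumes "a > 0" "x > 0"
  shows set_integrable_powr: "set_integrable lborel {0<..<x} (\<lambda>t. t powr (a - 1))"
    and set_integral_powr: "(LINT t:{0<..<x}|lborel. t powr (a - 1)) = x powr a / a"
    and set_integrable_powr_reflect: "set_integrable lborel {0<..<x} (\<lambda>t. (x - t) powr (a - 1))"
    and set_integral_powr_reflect: "(LINT t:{0<..<x}|lborel. (x - t) powr (a - 1)) = x powr a / a"
proof -
  have B: "Beta a 1 = 1 / a" "Beta 1 a = 1 / a"
    using assms Gamma_plus1[of a] Gamma_real_pos[OF assms(1), THEN less_imp_neq]
    by (auto simp: Beta_def add.commute[of 1] nonpos_Ints_def)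
  have 1: "(x - t) powr (1 - 1) * t powr (a - 1) = t powr (a - 1)"
    and 2: "(x - t) powr (a - 1) * t powr (1 - 1) = (x - t) powr (a - 1)" if "t \<in> {0<..<x}" for t
    using that by auto
  show "set_integrable lborel {0<..<x} (\<lambda>t. t powr (a - 1))"
    using set_integrable_Beta_scaled[of 1 a x] assms
    by (subst set_integrable_cong[OF refl refl 1[symmetric]]) auto
  show "(LINT t:{0<..<x}|lborel. t powr (a - 1)) = x powr a / a"
    using set_integral_Beta_scaled[of 1 a x] assms B
    by (subst set_lebesgue_integral_cong[where g = "\<lambda>t. (x - t) powr (1 - 1) * t powr (a - 1)"]) auto
  show "set_integrable lborel {0<..<x} (\<lambda>t. (x - t) powr (a - 1))"
    using set_integrable_Beta_scaled[of a 1 x] assms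
    by (subst set_integrable_cong[OF refl refl 2[symmetric]]) auto
  show "(LINT t:{0<..<x}|lborel. (x - t) powr (a - 1)) = x powr a / a"
    using set_integral_Beta_scaled[of a 1 x] assms B
    by (subst set_lebesgue_integral_cong[where g = "\<lambda>t. (x - t) powr (a - 1) * t powr (1 - 1)"]) auto
qed

text \<open>The primitive s^\<beta> / \<beta> tends to 0 at 0 because Re \<beta> > 0. The factor 1 /
  \<beta> obtained here is the one that becomes the coefficient \<beta> of the commutator, and
  finally \<alpha> in the theorem.\<close>

lemma
  fixes \<beta> :: complex and u :: real
  assumes "Re \<beta> > 0" "u > 0"
  shows set_integrable_complex_powr:
      "set_integrable lborel {0<..<u} (\<lambda>s. complex_of_real s powr (\<beta> - 1))"
    and set_integral_complex_powr:
      "(LINT s:{0<..<u}|lborel. complex_of_real s powr (\<beta> - 1)) = of_real u powr \<beta> / \<beta>"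
    and set_integral_norm_complex_powr:
      "(LINT s:{0<..<u}|lborel. norm (complex_of_real s powr (\<beta> - 1))) = u powr Re \<beta> / Re \<beta>"
proof -
  have R: "set_integrable lborel {0<..<u} (\<lambda>s. s powr (Re \<beta> - 1))"
    using assms by (rule set_integrable_powr)
  show int: "set_integrable lborel {0<..<u} (\<lambda>s. complex_of_real s powr (\<beta> - 1))"
    by (rule set_integrable_bound[OF R])
       (auto simp: set_borel_measurable_def norm_powr_real_powr)
  have "(LBINT s=ereal 0..ereal u. complex_of_real s powr (\<beta> - 1)) = of_real u powr \<beta> / \<beta> - 0"
  proof (rule interval_integral_FTC_integrable[where F = "\<lambda>s. complex_of_real s powr \<beta> / \<beta>"])
    show "((\<lambda>s. complex_of_real s powr \<beta> / \<beta>) has_vector_derivative complex_of_real s powr (\<beta> - 1)) (at s)"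
      if "ereal 0 < ereal s" "ereal s < ereal u" for s
    proof -
      have "((\<lambda>z. z powr \<beta> / \<beta>) has_field_derivative of_real s powr (\<beta> - 1)) (at (of_real s))"
        using that assms(1) by (auto intro!: derivative_eq_intros simp: complex_nonpos_Reals_iff)
      then show ?thesis
        by (intro has_vector_derivative_real_field)
    qed
    show "(((\<lambda>s. complex_of_real s powr \<beta> / \<beta>) \<circ> real_of_ereal) \<longlongrightarrow> 0) (at_right (ereal 0))"
    proof -
      have "((\<lambda>s. complex_of_real s) \<longlongrightarrow> of_real 0) (at_right 0)" by (intro tendsto_intros)
      then have "((\<lambda>s. complex_of_real s powr \<beta>) \<longlongrightarrow> 0) (at_right 0)"
        using assms by (intro tendsto_powr_complex_0[where b = \<beta>]) auto
      then show ?thesis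
        unfolding ereal_tendsto_simps by (rule tendsto_divide_zero)
    qed
    have "\<beta> \<noteq> 0" using assms(1) by auto
    then show "(((\<lambda>s. complex_of_real s powr \<beta> / \<beta>) \<circ> real_of_ereal) \<longlongrightarrow> of_real u powr \<beta> / \<beta>) (at_left (ereal u))"
      unfolding ereal_tendsto_simps using assms
      by (intro tendsto_intros tendsto_powr_complex) (auto simp: complex_nonpos_Reals_iff)
    show "isCont (\<lambda>s. complex_of_real s powr (\<beta> - 1)) s" if "ereal 0 < ereal s" "ereal s < ereal u" for s
      using that by (intro continuous_intros) (auto simp: complex_nonpos_Reals_iff)
  qed (use assms int in \<open>auto simp: einterval_eq\<close>)
  then show "(LINT s:{0<..<u}|lborel. complex_of_real s powr (\<beta> - 1)) = of_real u powr \<beta> / \<beta>"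
    using assms by (simp add: interval_lebesgue_integral_def einterval_eq)
  have "(LINT s:{0<..<u}|lborel. norm (complex_of_real s powr (\<beta> - 1))) =
     (LINT s:{0<..<u}|lborel. s powr (Re \<beta> - 1))"
    by (rule set_lebesgue_integral_cong) (auto simp: norm_powr_real_powr)
  also have "\<dots> = u powr Re \<beta> / Re \<beta>"
    using assms by (rule set_integral_powr)
  finally show "(LINT s:{0<..<u}|lborel. norm (complex_of_real s powr (\<beta> - 1))) = u powr Re \<beta> / Re \<beta>" .
qed

section \<open>The kernels \<open>E\<^sub>\<beta>\<close>\<close>

definition E_density :: "complex \<Rightarrow> complex \<Rightarrow> real \<Rightarrow> real \<Rightarrow> complex" where
  "E_density C \<beta> s x =
     rGamma (of_real s) * exp (- C * of_real s) * of_real s powr (\<beta> - 1) * of_real (x powr (s - 1))"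

text \<open>The integrand of x E_\<beta>(x) after 1 / \<Gamma>(s) = s / \<Gamma>(s + 1). The gained
  factor s raises the power from \<beta> - 1 to \<beta>, so the integral over s converges for Re
  \<beta> > -1, in particular for \<beta> = 0.\<close>

definition xE_density :: "complex \<Rightarrow> complex \<Rightarrow> real \<Rightarrow> real \<Rightarrow> complex" where
  "xE_density C \<beta> s x =
     of_real (rGamma (s + 1)) * exp (- C * of_real s) * of_real s powr \<beta> * of_real (x powr s)"

lemma E_eq: "E C \<beta> x = (LINT s:{0<..}|lborel. E_density C \<beta> s x)"
  by (simp add: E_def E_density_def rGamma_inverse_Gamma divide_inverse)

lemma E_density_measurable [measurable]:
  assumes [measurable]: "f \<in> borel_measurable M" "g \<in> borel_measurable M"
  shows "(\<lambda>z. E_density C \<beta> (f z) (g z)) \<in> borel_measurable M"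
  unfolding E_density_def by measurable

lemma xE_density_measurable [measurable]:
  assumes [measurable]: "f \<in> borel_measurable M" "g \<in> borel_measurable M"
  shows "(\<lambda>z. xE_density C \<beta> (f z) (g z)) \<in> borel_measurable M"
  unfolding xE_density_def by measurable

lemma E_measurable [measurable]: "E C \<beta> \<in> borel_measurable borel"
  unfolding E_eq set_lebesgue_integral_def by measurable

lemma E_density_eq:
  assumes "s > 0"
  shows "E_density C \<beta> s x =
    of_real (rGamma (s + 1)) * exp (- C * of_real s) * of_real s powr \<beta> * of_real (x powr (s - 1))"
proof -
  have "rGamma (complex_of_real s) = of_real s * of_real (rGamma (s + 1))"
    using rGamma_plus1[of s] by (simp add: rGamma_complex_of_real flip: of_real_mult)
  moreover have "of_real s * complex_of_real s powr (\<beta> - 1) = of_real s powr \<beta>"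
    using assms by (simp add: powr_diff)
  ultimately show ?thesis
    by (simp add: E_density_def)
qed

lemma mult_E_density:
  assumes "s > 0" "x > 0"
  shows "of_real x * E_density C \<beta> s x = xE_density C \<beta> s x"
  using assms by (simp add: E_density_eq xE_density_def powr_diff)

lemma norm_E_density:
  assumes "s > 0"
  shows "norm (E_density C \<beta> s x) = rGamma (s + 1) * s powr Re \<beta> * exp (- Re C * s) * x powr (s - 1)"
  using assms rGamma_real_nonneg[of s] unfolding E_density_eq[OF assms]
  by (simp add: norm_mult norm_powr_real_powr)

lemma norm_xE_density:
  assumes "s > 0"
  shows "norm (xE_density C \<beta> s x) = rGamma (s + 1) * s powr Re \<beta> * exp (- Re C * s) * x powr s"
  using assms rGamma_real_nonneg[of s] unfolding xE_density_def
  by (simp add: norm_mult norm_powr_real_powr)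

lemma mult_E_eq:
  assumes "x > 0"
  shows "of_real x * E C \<beta> x = (LINT s:{0<..}|lborel. xE_density C \<beta> s x)"
  unfolding E_eq set_integral_mult_right[symmetric]
  using assms by (intro set_lebesgue_integral_cong) (auto simp: mult_E_density)

lemma set_integrable_xE_density:
  assumes "x > 0" "Re \<beta> > -1"
  shows "set_integrable lborel {0<..} (\<lambda>s. xE_density C \<beta> s x)"
proof (rule set_integrable_bound[OF set_integrable_rGamma_weight[of "Re \<beta> + 1" "ln x - Re C"]])
  show "AE s in lborel. s \<in> {0<..} \<longrightarrow> norm (xE_density C \<beta> s x)
     \<le> norm (rGamma (s + 1) * s powr (Re \<beta> + 1 - 1) * exp ((ln x - Re C) * s))"
    using assms rGamma_real_nonneg
    by (intro AE_I2) (auto simp: norm_xE_density powr_def[of x] abs_mult algebra_simps exp_diff exp_minus field_simps)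
qed (use assms in \<open>auto simp: set_borel_measurable_def\<close>)

lemma norm_set_lebesgue_integral_le:
  fixes f :: "'a \<Rightarrow> 'b::{banach, second_countable_topology}"
  shows "norm (LINT x:A|M. f x) \<le> (LINT x:A|M. norm (f x))"
  using integral_norm_bound[of M "\<lambda>x. indicator A x *\<^sub>R f x"]
  by (simp add: set_lebesgue_integral_def)

text \<open>For s > 0 the factor x^s increases with x, so the absolute integral at the right end w
  bounds all the others. That absolute integral is bounded along with the modulus because it is the
  quantity needed to exchange integrals.\<close>

lemma mult_E_bounded:
  assumes "w > 0" "Re \<beta> > -1"
  shows "\<exists>M\<ge>0. \<forall>x\<in>{0<..w}. (LINT s:{0<..}|lborel. norm (xE_density C \<beta> s x)) \<le> M
           \<and> norm (of_real x * E C \<beta> x) \<le> M"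
proof (intro exI conjI ballI)
  let ?M = "LINT s:{0<..}|lborel. norm (xE_density C \<beta> s w)"
  show "?M \<ge> 0"
    unfolding set_lebesgue_integral_def by (intro Bochner_Integration.integral_nonneg) auto
  fix x assume x: "x \<in> {0<..w}"
  show 1: "(LINT s:{0<..}|lborel. norm (xE_density C \<beta> s x)) \<le> ?M"
  proof (rule set_integral_mono)
    show "norm (xE_density C \<beta> s x) \<le> norm (xE_density C \<beta> s w)" if "s \<in> {0<..}" for s
      using that x rGamma_real_nonneg[of s]
      by (auto simp: norm_xE_density intro!: mult_left_mono powr_mono2)
  qed (use x assms set_integrable_norm[OF set_integrable_xE_density] in auto)
  show "norm (of_real x * E C \<beta> x) \<le> ?M"
    using norm_set_lebesgue_integral_le[of lborel "{0<..}" "\<lambda>s. xE_density C \<beta> s x"] 1 x assms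
    by (simp add: mult_E_eq)
qed

lemma set_integrable_complex_of_real:
  "set_integrable M A f \<Longrightarrow> set_integrable M A (\<lambda>x. complex_of_real (f x))"
  unfolding set_integrable_def by (drule integrable_of_real[where 'a = complex]) (simp add: scaleR_conv_of_real)

text \<open>Here x^s / s is the integral of t^(s - 1) over (0, x). Integrating in x first thus costs
  a factor 1 / s and lowers the exponent of s to b - 1, which is why integrability of E_\<beta>
  calls for Re \<beta> > 0.\<close>

lemma powr_weight_eq:
  fixes b c s x :: real
  assumes "s > 0" "x > 0"
  shows "rGamma (s + 1) * s powr b * exp (- c * s) * (x powr s / s) =
    rGamma (s + 1) * s powr (b - 1) * exp ((ln x - c) * s)"
proof -
  have "exp ((ln x - c) * s) = exp (- c * s) * x powr s"
    using assms by (simp add: powr_def algebra_simps flip: exp_add)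
  then show ?thesis
    using assms by (simp add: powr_diff)
qed

lemma set_integrable_E:
  assumes "Re \<beta> > 0" "w > 0"
  shows "set_integrable lborel {0<..<w} (E C \<beta>)"
proof -
  let ?G = "\<lambda>s. rGamma (s + 1) * s powr (Re \<beta> - 1) * exp ((ln w - Re C) * s)"
  have "set_integrable lborel {0<..<w} (\<lambda>x. LINT s:{0<..}|lborel. E_density C \<beta> s x)"
  proof (rule set_Fubini(3)[where G = ?G])
    fix s :: real assume "s \<in> {0<..}"
    then have s: "s > 0" by simp
    have 1: "set_integrable lborel {0<..<w} (\<lambda>x. x powr (s - 1))"
      using s assms by (intro set_integrable_powr)
    then show "set_integrable lborel {0<..<w} (E_density C \<beta> s)"
      unfolding E_density_def[abs_def]
      by (intro set_integrable_mult_right set_integrable_complex_of_real)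
    have "(LINT x:{0<..<w}|lborel. norm (E_density C \<beta> s x)) = ?G s"
      using s assms powr_weight_eq[of s w]
      by (simp only: norm_E_density set_integral_mult_right set_integral_powr)
    then show "(LINT x:{0<..<w}|lborel. norm (E_density C \<beta> s x)) \<le> ?G s" by simp
  qed (use assms in \<open>auto intro: set_integrable_rGamma_weight\<close>)
  then show ?thesis by (simp flip: E_eq)
qed

text \<open>A single s of E_\<beta> is treated at a time. The kernels of index s and r + 1 convolve
  to index s + r + 1, the exponentials multiply to e^(-C (s + r)), and u = s + r becomes the new
  variable. The exchange of t and r is justified by the bounded absolute r-integral times the
  integrable (x - t)^(s - 1).\<close>

lemma E_density_convolution_mult_E:
  assumes "s > 0" "x > 0"
  shows "(LINT t:{0<..<x}|lborel. E_density C \<beta> s (x - t) * (of_real t * E C 0 t)) =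
         of_real s powr (\<beta> - 1) * (LINT u:{s<..}|lborel. xE_density C 0 u x)"
proof -
  obtain M where M: "M \<ge> 0"
    "\<And>t. t \<in> {0<..x} \<Longrightarrow> (LINT r:{0<..}|lborel. norm (xE_density C 0 r t)) \<le> M"
    using mult_E_bounded[OF \<open>x > 0\<close>, of 0 C] by auto
  let ?c = "rGamma (of_real s) * exp (- C * of_real s) * of_real s powr (\<beta> - 1)"
  let ?F = "\<lambda>t r. complex_of_real ((x - t) powr (s - 1)) * xE_density C 0 r t"
  have "(LINT t:{0<..<x}|lborel. E_density C \<beta> s (x - t) * (of_real t * E C 0 t)) =
        (LINT t:{0<..<x}|lborel. ?c * (LINT r:{0<..}|lborel. ?F t r))"
    by (intro set_lebesgue_integral_cong) (auto simp: E_density_def mult_E_eq)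
  also have "\<dots> = ?c * (LINT t:{0<..<x}|lborel. LINT r:{0<..}|lborel. ?F t r)"
    by (rule set_integral_mult_right)
  also have "(LINT t:{0<..<x}|lborel. LINT r:{0<..}|lborel. ?F t r) =
             (LINT r:{0<..}|lborel. LINT t:{0<..<x}|lborel. ?F t r)"
  proof (rule set_Fubini(1)[where G = "\<lambda>t. (x - t) powr (s - 1) * M"])
    fix t :: real assume t: "t \<in> {0<..<x}"
    show "set_integrable lborel {0<..} (?F t)"
      using set_integrable_xE_density[of t 0 C] t by (intro set_integrable_mult_right) auto
    have "(LINT r:{0<..}|lborel. norm (?F t r)) =
          (x - t) powr (s - 1) * (LINT r:{0<..}|lborel. norm (xE_density C 0 r t))"
      by (simp add: norm_mult)
    also have "\<dots> \<le> (x - t) powr (s - 1) * M"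
      using M(2)[of t] t by (intro mult_left_mono) auto
    finally show "(LINT r:{0<..}|lborel. norm (?F t r)) \<le> (x - t) powr (s - 1) * M" .
  next
    show "set_integrable lborel {0<..<x} (\<lambda>t. (x - t) powr (s - 1) * M)"
      using set_integrable_powr_reflect[of s x] assms by (intro set_integrable_mult_left) auto
  qed auto
  also have "?c * \<dots> = (LINT r:{0<..}|lborel. ?c * (LINT t:{0<..<x}|lborel. ?F t r))"
    by (rule set_integral_mult_right[symmetric])
  also have "\<dots> = (LINT r:{0<..}|lborel. of_real s powr (\<beta> - 1) * xE_density C 0 (s + r) x)"
  proof (rule set_lebesgue_integral_cong)
    show "\<forall>r. r \<in> {0<..} \<longrightarrow> ?c * (LINT t:{0<..<x}|lborel. ?F t r) =
       of_real s powr (\<beta> - 1) * xE_density C 0 (s + r) x"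
    proof (intro allI impI)
      fix r :: real assume "r \<in> {0<..}"
      then have r: "r > 0" by simp
      \<comment> \<open>Writing t^r with exponent r + 1 - 1 exposes the Beta integral with
        parameters s and r + 1. The factor r^0 of the density is 1 because r > 0.\<close>
      have "(LINT t:{0<..<x}|lborel. ?F t r) =
         (LINT t:{0<..<x}|lborel. (of_real (rGamma (r + 1)) * exp (- C * of_real r)) *
            of_real ((x - t) powr (s - 1) * t powr (r + 1 - 1)))"
        using r by (intro set_lebesgue_integral_cong) (auto simp: xE_density_def)
      also have "\<dots> = (of_real (rGamma (r + 1)) * exp (- C * of_real r)) *
         of_real (x powr (s + (r + 1) - 1) * Beta s (r + 1))"
        using assms r by (simp only: set_integral_mult_right set_integral_complex_of_real set_integral_Beta_scaled)
      also have "Beta s (r + 1) = Gamma s * Gamma (r + 1) * rGamma (s + r + 1)"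
        by (simp add: Beta_altdef add.assoc)
      finally have 1: "(LINT t:{0<..<x}|lborel. ?F t r) =
        (of_real (rGamma (r + 1)) * exp (- C * of_real r)) *
         of_real (x powr (s + r) * (Gamma s * Gamma (r + 1) * rGamma (s + r + 1)))"
        by (simp add: algebra_simps)
      \<comment> \<open>The Gamma factors in the numerator of B(s, r + 1) cancel the normalisations
        of the two densities, leaving only the reciprocal of \<Gamma>(s + r + 1).\<close>
      have "rGamma s * Gamma s = 1" "rGamma (r + 1) * Gamma (r + 1) = 1"
        using assms r Gamma_real_pos[of s] Gamma_real_pos[of "r + 1"]
        by (auto simp: rGamma_inverse_Gamma simp del: Gamma_real_pos)
      then have 2: "complex_of_real (rGamma s) * of_real (Gamma s) = 1"
        "complex_of_real (rGamma (r + 1)) * of_real (Gamma (r + 1)) = 1"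
        by (simp_all flip: of_real_mult)
      have "?c * (LINT t:{0<..<x}|lborel. ?F t r) =
        (complex_of_real (rGamma s) * of_real (Gamma s)) *
        (complex_of_real (rGamma (r + 1)) * of_real (Gamma (r + 1))) *
        (of_real s powr (\<beta> - 1) * (of_real (rGamma (s + r + 1)) *
          (exp (- C * of_real s) * exp (- C * of_real r)) * of_real (x powr (s + r))))"
        unfolding 1 rGamma_complex_of_real of_real_mult by (simp only: mult_ac)
      also have "\<dots> = of_real s powr (\<beta> - 1) * (of_real (rGamma (s + r + 1)) *
          (exp (- C * of_real s) * exp (- C * of_real r)) * of_real (x powr (s + r)))"
        unfolding 2 by simp
      also have "exp (- C * of_real s) * exp (- C * of_real r) = exp (- C * of_real (s + r))"
        by (simp add: algebra_simps flip: exp_add)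
      also have "of_real (rGamma (s + r + 1)) * exp (- C * of_real (s + r)) * of_real (x powr (s + r)) =
        xE_density C 0 (s + r) x"
        using assms r by (auto simp: xE_density_def complex_eq_iff)
      finally show "?c * (LINT t:{0<..<x}|lborel. ?F t r) =
        of_real s powr (\<beta> - 1) * xE_density C 0 (s + r) x" .
    qed
  qed auto
  also have "\<dots> = of_real s powr (\<beta> - 1) * (LINT r:{0<..}|lborel. xE_density C 0 (s + r) x)"
    by (rule set_integral_mult_right)
  also have "(LINT r:{0<..}|lborel. xE_density C 0 (s + r) x) = (LINT u:{s<..}|lborel. xE_density C 0 u x)"
    unfolding set_lebesgue_integral_def
    by (subst (2) lborel_integral_real_affine[where c = 1 and t = s])
       (auto intro!: Bochner_Integration.integral_cong simp: indicator_def)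
  finally show ?thesis .
qed

text \<open>Both exchanges of integrals rest on the integrability of s^(Re \<beta> - 1) at 0, so the
  identity is obtained for Re \<beta> > 0 and will reach Re \<alpha> = 0 only through the strong
  limit.\<close>

lemma E_convolution_mult_E:
  assumes "Re \<beta> > 0" "x > 0"
  shows "(LINT t:{0<..<x}|lborel. E C \<beta> (x - t) * (of_real t * E C 0 t)) = of_real x * E C \<beta> x / \<beta>"
proof -
  obtain M where M: "M \<ge> 0" "\<And>t. t \<in> {0<..x} \<Longrightarrow> norm (of_real t * E C 0 t) \<le> M"
    using mult_E_bounded[OF \<open>x > 0\<close>, of 0 C] by auto
  let ?w = "\<lambda>s. rGamma (s + 1) * s powr (Re \<beta> - 1) * exp ((ln x - Re C) * s)"
  let ?F1 = "\<lambda>s t. E_density C \<beta> s (x - t) * (of_real t * E C 0 t)"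
  \<comment> \<open>The triangle 0 < s < u is encoded by an indicator on the quadrant, so that
    Fubini for product sets applies.\<close>
  let ?F2 = "\<lambda>u s. indicat_real {0<..<u} s *\<^sub>R (of_real s powr (\<beta> - 1) * xE_density C 0 u x)"
  have "(LINT t:{0<..<x}|lborel. E C \<beta> (x - t) * (of_real t * E C 0 t)) =
        (LINT t:{0<..<x}|lborel. LINT s:{0<..}|lborel. ?F1 s t)"
    unfolding E_eq[of _ \<beta>] by simp
  also have "\<dots> = (LINT s:{0<..}|lborel. LINT t:{0<..<x}|lborel. ?F1 s t)"
  proof (rule set_Fubini(1)[where G = "\<lambda>s. ?w s * M", symmetric])
    fix s :: real assume "s \<in> {0<..}"
    then have s: "s > 0" by simp
    have 1: "set_integrable lborel {0<..<x} (\<lambda>t. E_density C \<beta> s (x - t) * of_real M)"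
      unfolding E_density_def using set_integrable_powr_reflect[of s x] s assms
      by (intro set_integrable_mult_left set_integrable_mult_right set_integrable_complex_of_real) auto
    have 2: "norm (?F1 s t) \<le> norm (E_density C \<beta> s (x - t) * of_real M)" if "t \<in> {0<..<x}" for t
      unfolding norm_mult[of "E_density _ _ _ _"] using that M(1) M(2)[of t]
      by (intro mult_left_mono) auto
    show 3: "set_integrable lborel {0<..<x} (?F1 s)"
      using 2 by (intro set_integrable_bound[OF 1]) (auto simp: set_borel_measurable_def)
    \<comment> \<open>With t E_0(t) bounded by M, only the integral x^s / s of (x - t)^(s - 1)
      remains, and \<open>powr_weight_eq\<close> turns it into the weight.\<close>
    have "(LINT t:{0<..<x}|lborel. norm (?F1 s t)) \<le>
          (LINT t:{0<..<x}|lborel. norm (E_density C \<beta> s (x - t) * of_real M))"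
      using 2 by (intro set_integral_mono set_integrable_norm 1 3) auto
    also have "\<dots> = (LINT t:{0<..<x}|lborel.
        rGamma (s + 1) * s powr Re \<beta> * exp (- Re C * s) * (x - t) powr (s - 1)) * M"
      using s M(1) by (simp add: norm_mult norm_E_density)
    also have "\<dots> = ?w s * M"
      using s assms powr_weight_eq[of s x]
      by (simp only: set_integral_mult_right set_integral_powr_reflect)
    finally show "(LINT t:{0<..<x}|lborel. norm (?F1 s t)) \<le> ?w s * M" .
  qed (use assms in \<open>auto intro!: set_integrable_rGamma_weight set_integrable_mult_left\<close>)
  also have "\<dots> = (LINT s:{0<..}|lborel. of_real s powr (\<beta> - 1) * (LINT u:{s<..}|lborel. xE_density C 0 u x))"
    using assms by (intro set_lebesgue_integral_cong) (auto simp: E_density_convolution_mult_E)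
  also have "\<dots> = (LINT s:{0<..}|lborel. LINT u:{0<..}|lborel. ?F2 u s)"
  proof (intro set_lebesgue_integral_cong allI impI)
    fix s :: real assume s: "s \<in> {0<..}"
    show "of_real s powr (\<beta> - 1) * (LINT u:{s<..}|lborel. xE_density C 0 u x) =
      (LINT u:{0<..}|lborel. ?F2 u s)"
      unfolding set_integral_mult_right[symmetric] unfolding set_lebesgue_integral_def
      using s by (intro Bochner_Integration.integral_cong) (auto simp: indicator_def)
  qed auto
  also have "\<dots> = (LINT u:{0<..}|lborel. LINT s:{0<..}|lborel. ?F2 u s)"
  proof (rule set_Fubini(1)[where G = "\<lambda>u. norm (xE_density C \<beta> u x) / Re \<beta>", symmetric])
    fix u :: real assume "u \<in> {0<..}"
    then have u: "u > 0" by simp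
    have eq: "indicat_real {0<..} s *\<^sub>R ?F2 u s =
        indicat_real {0<..<u} s *\<^sub>R (of_real s powr (\<beta> - 1) * xE_density C 0 u x)" for s
      by (auto simp: indicator_def)
    show "set_integrable lborel {0<..} (?F2 u)"
      unfolding set_integrable_def eq
      using set_integrable_mult_left[OF set_integrable_complex_powr[OF assms(1) u]]
      by (simp add: set_integrable_def)
    have "(LINT s:{0<..}|lborel. norm (?F2 u s)) =
       (LINT s:{0<..<u}|lborel. norm (complex_of_real s powr (\<beta> - 1)) * norm (xE_density C 0 u x))"
      unfolding set_lebesgue_integral_def
      by (intro Bochner_Integration.integral_cong) (auto simp: indicator_def norm_mult)
    also have "\<dots> = u powr Re \<beta> / Re \<beta> * norm (xE_density C 0 u x)"
      using set_integral_norm_complex_powr[OF assms(1) u] by simp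
    also have "\<dots> = norm (xE_density C \<beta> u x) / Re \<beta>"
      using u by (simp add: norm_xE_density)
    finally show "(LINT s:{0<..}|lborel. norm (?F2 u s)) \<le> norm (xE_density C \<beta> u x) / Re \<beta>" by simp
  next
    show "set_integrable lborel {0<..} (\<lambda>u. norm (xE_density C \<beta> u x) / Re \<beta>)"
      using assms by (intro set_integrable_divide set_integrable_norm set_integrable_xE_density) auto
    show "case_prod ?F2 \<in> borel_measurable (lborel \<Otimes>\<^sub>M lborel)"
      by (simp add: indicator_def[abs_def] of_bool_def)
  qed auto
  also have "\<dots> = (LINT u:{0<..}|lborel. xE_density C \<beta> u x / \<beta>)"
  proof (intro set_lebesgue_integral_cong allI impI)
    fix u :: real assume "u \<in> {0<..}"
    then have u: "u > 0" by simp
    have "(LINT s:{0<..}|lborel. ?F2 u s) =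
       (LINT s:{0<..<u}|lborel. of_real s powr (\<beta> - 1) * xE_density C 0 u x)"
      unfolding set_lebesgue_integral_def
      by (intro Bochner_Integration.integral_cong) (auto simp: indicator_def)
    also have "\<dots> = of_real u powr \<beta> / \<beta> * xE_density C 0 u x"
      using set_integral_complex_powr[OF assms(1) u] by simp
    \<comment> \<open>The densities of order 0 and \<beta> differ exactly by the factor
      u^\<beta>.\<close>
    also have "\<dots> = xE_density C \<beta> u x / \<beta>"
      using u by (simp add: xE_density_def)
    finally show "(LINT s:{0<..}|lborel. ?F2 u s) = xE_density C \<beta> u x / \<beta>" .
  qed auto
  also have "\<dots> = of_real x * E C \<beta> x / \<beta>"
    using assms by (simp add: mult_E_eq)
  finally show ?thesis .
qed

section \<open>Convolutions\<close>

lemma set_integrable_reflect: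
  fixes f :: "real \<Rightarrow> 'a::{banach, second_countable_topology}"
  assumes "set_integrable lborel {0<..<x} f"
  shows "set_integrable lborel {0<..<x} (\<lambda>t. f (x - t))"
proof -
  have "integrable lborel (\<lambda>t. indicat_real {0<..<x} (x + (-1) * t) *\<^sub>R f (x + (-1) * t))"
    using assms unfolding set_integrable_def by (rule lborel_integrable_real_affine) simp
  then show ?thesis
    unfolding set_integrable_def
    by (rule Bochner_Integration.integrable_cong[THEN iffD1, rotated 2]) (auto simp: indicator_def)
qed

text \<open>The roles are f = E_\<beta> (integrable), g = x E_0(x) (bounded) and h the L^2 function
  (integrable). Boundedness of the middle factor makes the double integral absolutely convergent at
  the given x, with no exceptional null set.\<close>

lemma convolution_assoc:
  fixes f g h :: "real \<Rightarrow> complex"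
  assumes [measurable]: "f \<in> borel_measurable borel" "g \<in> borel_measurable borel" "h \<in> borel_measurable borel"
    and f: "set_integrable lborel {0<..<x} f"
    and g: "\<And>t. t \<in> {0<..<x} \<Longrightarrow> norm (g t) \<le> M"
    and h: "set_integrable lborel {0<..<x} h"
  shows "(LINT t:{0<..<x}|lborel. f (x - t) * (LINT y:{0<..<t}|lborel. g (t - y) * h y)) =
         (LINT y:{0<..<x}|lborel. (LINT t:{0<..<x - y}|lborel. f (x - y - t) * g t) * h y)"
proof -
  \<comment> \<open>The indicator restricts the square to the triangle y < t.\<close>
  let ?F = "\<lambda>y t. indicat_real {y<..} t *\<^sub>R (f (x - t) * g (t - y) * h y)"
  let ?N = "LINT t:{0<..<x}|lborel. norm (f (x - t))"
  note f' = set_integrable_reflect[OF f]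
  have "(LINT t:{0<..<x}|lborel. f (x - t) * (LINT y:{0<..<t}|lborel. g (t - y) * h y)) =
        (LINT t:{0<..<x}|lborel. LINT y:{0<..<x}|lborel. ?F y t)"
  proof (intro set_lebesgue_integral_cong allI impI)
    fix t assume t: "t \<in> {0<..<x}"
    show "f (x - t) * (LINT y:{0<..<t}|lborel. g (t - y) * h y) = (LINT y:{0<..<x}|lborel. ?F y t)"
      unfolding set_integral_mult_right[symmetric] unfolding set_lebesgue_integral_def
      using t by (intro Bochner_Integration.integral_cong) (auto simp: indicator_def)
  qed auto
  also have "\<dots> = (LINT y:{0<..<x}|lborel. LINT t:{0<..<x}|lborel. ?F y t)"
  proof (rule set_Fubini(1)[where G = "\<lambda>y. ?N * (M * norm (h y))", symmetric])
    fix y assume y: "y \<in> {0<..<x}"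
    have le: "norm (?F y t) \<le> norm (f (x - t)) * (M * norm (h y))" if "t \<in> {0<..<x}" for t
    proof (cases "y < t")
      case True
      then have "norm (g (t - y)) * norm (h y) \<le> M * norm (h y)"
        using that y by (intro mult_right_mono g) auto
      then have "norm (f (x - t)) * (norm (g (t - y)) * norm (h y)) \<le> norm (f (x - t)) * (M * norm (h y))"
        by (rule mult_left_mono) simp
      then show ?thesis
        using True by (simp add: norm_mult mult_ac)
    next
      case False
      moreover have "0 \<le> M"
        using g[OF y] norm_ge_zero[of "g y"] by linarith
      ultimately show ?thesis by simp
    qed
    have 1: "set_integrable lborel {0<..<x} (\<lambda>t. norm (f (x - t)) * (M * norm (h y)))"
      using f' by (intro set_integrable_mult_left set_integrable_norm)
    show 2: "set_integrable lborel {0<..<x} (?F y)"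
    proof (rule set_integrable_bound[OF 1])
      show "AE t in lborel. t \<in> {0<..<x} \<longrightarrow> norm (?F y t) \<le> norm (norm (f (x - t)) * (M * norm (h y)))"
        using le by (intro AE_I2 impI order_trans[OF le]) auto
    qed (simp add: set_borel_measurable_def)
    have "(LINT t:{0<..<x}|lborel. norm (?F y t)) \<le>
          (LINT t:{0<..<x}|lborel. norm (f (x - t)) * (M * norm (h y)))"
      using le by (intro set_integral_mono set_integrable_norm 1 2)
    then show "(LINT t:{0<..<x}|lborel. norm (?F y t)) \<le> ?N * (M * norm (h y))"
      by simp
  next
    show "case_prod ?F \<in> borel_measurable (lborel \<Otimes>\<^sub>M lborel)"
      by (simp add: indicator_def[abs_def] of_bool_def)
    show "set_integrable lborel {0<..<x} (\<lambda>y. ?N * (M * norm (h y)))"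
      using h by (intro set_integrable_mult_right set_integrable_norm)
  qed auto
  also have "\<dots> = (LINT y:{0<..<x}|lborel. (LINT t:{0<..<x - y}|lborel. f (x - y - t) * g t) * h y)"
  proof (intro set_lebesgue_integral_cong allI impI)
    fix y assume y: "y \<in> {0<..<x}"
    have "(LINT t:{0<..<x}|lborel. ?F y t) = (LINT t:{y<..<x}|lborel. f (x - t) * g (t - y) * h y)"
      unfolding set_lebesgue_integral_def
      using y by (intro Bochner_Integration.integral_cong) (auto simp: indicator_def)
    \<comment> \<open>Shifting t by y recovers the convolution of f and g at x - y.\<close>
    also have "\<dots> = (LINT t:{0<..<x - y}|lborel. f (x - y - t) * g t * h y)"
      unfolding set_lebesgue_integral_def
      by (subst lborel_integral_real_affine[where c = 1 and t = y])
         (auto intro!: Bochner_Integration.integral_cong simp: indicator_def algebra_simps)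
    finally show "(LINT t:{0<..<x}|lborel. ?F y t) =
        (LINT t:{0<..<x - y}|lborel. f (x - y - t) * g t) * h y" by simp
  qed auto
  finally show ?thesis .
qed

text \<open>Both factors are merely integrable, so the product can fail to be integrable for
  exceptional x. Tonelli over the triangle t < x leaves a null set of them; on it the integral in
  \<open>V\<close> may be the default value 0, and splitting it by linearity would be
  unjustified.\<close>

lemma AE_set_integrable_convolution:
  fixes f h :: "real \<Rightarrow> complex"
  assumes [measurable]: "f \<in> borel_measurable borel" "h \<in> borel_measurable borel"
    and f: "set_integrable lborel {0<..<w} f" and h: "set_integrable lborel {0<..<w} h"
  shows "AE x in lborel. x \<in> {0<..<w} \<longrightarrow> set_integrable lborel {0<..<x} (\<lambda>t. f (x - t) * h t)"
proof -
  let ?F = "\<lambda>t x. indicat_real {t<..} x *\<^sub>R (f (x - t) * h t)"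
  let ?N = "LINT x:{0<..<w}|lborel. norm (f x)"
  have "AE x in lborel. x \<in> {0<..<w} \<longrightarrow> set_integrable lborel {0<..<w} (\<lambda>t. ?F t x)"
  proof (rule set_Fubini(2)[where G = "\<lambda>t. ?N * norm (h t)"])
    fix t assume t: "t \<in> {0<..<w}"
    \<comment> \<open>Translation by t carries (0, w - t) to (t, w), which is where the indicator in
      \<open>?F\<close> equals 1 inside (0, w).\<close>
    have eq: "indicat_real {0<..<w - t} (- t + 1 * x) *\<^sub>R (f (- t + 1 * x) * h t) =
      indicat_real {0<..<w} x *\<^sub>R ?F t x" for x
      using t by (auto simp: indicator_def)
    have sub: "set_integrable lborel {0<..<w - t} (\<lambda>x. f x * h t)"
      by (rule set_integrable_mult_left, rule set_integrable_subset[OF f]) (use t in auto)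
    from lborel_integrable_real_affine[OF this[unfolded set_integrable_def], of 1 "- t"]
    show "set_integrable lborel {0<..<w} (?F t)"
      unfolding eq by (simp add: set_integrable_def)
    have "(LINT x:{0<..<w}|lborel. norm (?F t x)) = (LINT x:{0<..<w - t}|lborel. norm (f x * h t))"
      unfolding set_lebesgue_integral_def
      using t by (subst (2) lborel_integral_real_affine[where c = 1 and t = "- t"])
         (auto intro!: Bochner_Integration.integral_cong simp: indicator_def)
    also have "\<dots> = (LINT x:{0<..<w - t}|lborel. norm (f x)) * norm (h t)"
      by (simp add: norm_mult)
    also have "\<dots> \<le> ?N * norm (h t)"
      unfolding set_lebesgue_integral_def
      using f t by (intro mult_right_mono Bochner_Integration.integral_mono'
          set_integrable_norm[unfolded set_integrable_def]) (auto simp: set_integrable_def indicator_def)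
    finally show "(LINT x:{0<..<w}|lborel. norm (?F t x)) \<le> ?N * norm (h t)" .
  next
    show "case_prod ?F \<in> borel_measurable (lborel \<Otimes>\<^sub>M lborel)"
      by (simp add: indicator_def[abs_def] of_bool_def)
    show "set_integrable lborel {0<..<w} (\<lambda>t. ?N * norm (h t))"
      using h by (intro set_integrable_mult_right set_integrable_norm)
  qed auto
  then show ?thesis
  proof eventually_elim
    case (elim x)
    show ?case
    proof
      assume x: "x \<in> {0<..<w}"
      then have "set_integrable lborel {0<..<x} (\<lambda>t. ?F t x)"
        using elim by (auto elim!: set_integrable_subset)
      then show "set_integrable lborel {0<..<x} (\<lambda>t. f (x - t) * h t)"
        by (subst set_integrable_cong[OF refl refl, of _ _ "\<lambda>t. ?F t x"]) auto
    qed
  qed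
qed

section \<open>The space $L^2(0,\omega)$\<close>

lemma borel_measurable_interval_lborel_iff:
  fixes f :: "real \<Rightarrow> complex"
  shows "f \<in> borel_measurable (interval_lborel \<omega>) \<longleftrightarrow>
    (\<lambda>x. indicat_real {0<..<\<omega>} x *\<^sub>R f x) \<in> borel_measurable borel"
  by (subst borel_measurable_restrict_space_iff) auto

lemma AE_interval_lborel:
  "(AE x in interval_lborel \<omega>. P x) \<longleftrightarrow> (AE x in lborel. x \<in> {0<..<\<omega>} \<longrightarrow> P x)"
  by (subst AE_restrict_space_iff) auto

lemma finite_measure_interval_lborel: "finite_measure (interval_lborel \<omega>)"
  by (rule finite_measureI, cases "0 \<le> \<omega>") (auto simp: emeasure_restrict_space space_restrict_space)

lemma L2_measurable: "f \<in> L2 \<omega> \<Longrightarrow> f \<in> borel_measurable (interval_lborel \<omega>)"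
  by (simp add: L2_def)

lemma L2_bounded_by:
  assumes "g \<in> L2 \<omega>" "f \<in> borel_measurable (interval_lborel \<omega>)"
    and "\<And>x. x \<in> {0<..<\<omega>} \<Longrightarrow> norm (f x) \<le> c * norm (g x)"
  shows "f \<in> L2 \<omega>"
proof -
  have "integrable (interval_lborel \<omega>) (\<lambda>x. (norm (f x))\<^sup>2)"
  proof (rule Bochner_Integration.integrable_bound)
    show "integrable (interval_lborel \<omega>) (\<lambda>x. c\<^sup>2 * (norm (g x))\<^sup>2)"
      using assms by (simp add: L2_def)
    show "AE x in interval_lborel \<omega>. norm ((norm (f x))\<^sup>2) \<le> norm (c\<^sup>2 * (norm (g x))\<^sup>2)"
    proof (rule AE_I2)
      fix x assume "x \<in> space (interval_lborel \<omega>)"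
      then have "(norm (f x))\<^sup>2 \<le> (c * norm (g x))\<^sup>2"
        by (intro power_mono assms) (auto simp: space_restrict_space)
      then show "norm ((norm (f x))\<^sup>2) \<le> norm (c\<^sup>2 * (norm (g x))\<^sup>2)"
        by (simp add: power_mult_distrib)
    qed
  qed (use assms in measurable)
  then show ?thesis using assms by (simp add: L2_def)
qed

lemma bounded_in_L2:
  assumes "f \<in> borel_measurable (interval_lborel \<omega>)" "\<And>x. x \<in> {0<..<\<omega>} \<Longrightarrow> norm (f x) \<le> c"
  shows "f \<in> L2 \<omega>"
proof (rule L2_bounded_by[of "\<lambda>_. 1" _ _ c])
  show "(\<lambda>_. 1) \<in> L2 \<omega>"
    using finite_measure.integrable_const[OF finite_measure_interval_lborel, of \<omega> "1::real"] by (simp add: L2_def)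
qed (use assms in auto)

lemma L2_cmult: "f \<in> L2 \<omega> \<Longrightarrow> (\<lambda>x. c * f x) \<in> L2 \<omega>"
  by (rule L2_bounded_by[where c = "norm c"]) (auto simp: norm_mult dest: L2_measurable)

lemma L2_Q:
  assumes "f \<in> L2 \<omega>"
  shows "Q f \<in> L2 \<omega>"
proof (rule L2_bounded_by[OF assms])
  have "complex_of_real \<in> borel_measurable (interval_lborel \<omega>)"
    by (intro measurable_restrict_space1) simp
  then show "Q f \<in> borel_measurable (interval_lborel \<omega>)"
    unfolding Q_def by (rule borel_measurable_times) (rule L2_measurable[OF assms])
  show "norm (Q f x) \<le> \<omega> * norm (f x)" if "x \<in> {0<..<\<omega>}" for x
    using that by (auto simp: Q_def norm_mult intro!: mult_right_mono)
qed

text \<open>This crude inequality stands in for Minkowski's: its constants do no harm, as it only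
  has to give membership in L^2 and a bound that tends to 0.\<close>

lemma norm_add_power2_le: "(norm (a + b))\<^sup>2 \<le> 2 * (norm a)\<^sup>2 + 2 * (norm b)\<^sup>2"
  for a b :: "'a::real_normed_vector"
proof -
  have "(norm (a + b))\<^sup>2 \<le> (norm a + norm b)\<^sup>2"
    by (intro power_mono norm_triangle_ineq) auto
  also have "\<dots> \<le> 2 * (norm a)\<^sup>2 + 2 * (norm b)\<^sup>2"
    using sum_squares_bound[of "norm a" "norm b"] by (simp add: power2_sum)
  finally show ?thesis .
qed

lemma L2_add:
  assumes "f \<in> L2 \<omega>" "g \<in> L2 \<omega>"
  shows "(\<lambda>x. f x + g x) \<in> L2 \<omega>"
proof -
  have "integrable (interval_lborel \<omega>) (\<lambda>x. (norm (f x + g x))\<^sup>2)"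
  proof (rule Bochner_Integration.integrable_bound)
    show "integrable (interval_lborel \<omega>) (\<lambda>x. 2 * (norm (f x))\<^sup>2 + 2 * (norm (g x))\<^sup>2)"
      using assms by (simp add: L2_def)
    show "(\<lambda>x. (norm (f x + g x))\<^sup>2) \<in> borel_measurable (interval_lborel \<omega>)"
      using assms[THEN L2_measurable] by measurable
  qed (simp add: norm_add_power2_le)
  moreover have "(\<lambda>x. f x + g x) \<in> borel_measurable (interval_lborel \<omega>)"
    using assms by (intro borel_measurable_add L2_measurable)
  ultimately show ?thesis by (simp add: L2_def)
qed

lemma L2_diff:
  assumes "f \<in> L2 \<omega>" "g \<in> L2 \<omega>"
  shows "(\<lambda>x. f x - g x) \<in> L2 \<omega>"
  using L2_add[OF assms(1) L2_cmult[OF assms(2), of "-1"]] by simp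

lemma L2_norm_power2: "(L2_norm \<omega> f)\<^sup>2 = (LINT x|interval_lborel \<omega>. (norm (f x))\<^sup>2)"
  by (simp add: L2_norm_def)

lemma L2_norm_nonneg: "0 \<le> L2_norm \<omega> f"
  by (simp add: L2_norm_def)

lemma L2_norm_add_power2_le:
  assumes "f \<in> L2 \<omega>" "g \<in> L2 \<omega>"
  shows "(L2_norm \<omega> (\<lambda>x. f x + g x))\<^sup>2 \<le> 2 * (L2_norm \<omega> f)\<^sup>2 + 2 * (L2_norm \<omega> g)\<^sup>2"
proof -
  have "(LINT x|interval_lborel \<omega>. (norm (f x + g x))\<^sup>2) \<le>
    (LINT x|interval_lborel \<omega>. 2 * (norm (f x))\<^sup>2 + 2 * (norm (g x))\<^sup>2)"
    using assms L2_add[OF assms]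
    by (intro Bochner_Integration.integral_mono norm_add_power2_le) (auto simp: L2_def)
  then show ?thesis
    using assms by (simp add: L2_norm_power2 L2_def)
qed

lemma L2_norm_cmult: "L2_norm \<omega> (\<lambda>x. c * f x) = norm c * L2_norm \<omega> f"
  by (simp add: L2_norm_def norm_mult power_mult_distrib real_sqrt_mult)

lemma L2_norm_Q_le:
  assumes "f \<in> L2 \<omega>" "\<omega> > 0"
  shows "L2_norm \<omega> (Q f) \<le> \<omega> * L2_norm \<omega> f"
proof -
  have "(LINT x|interval_lborel \<omega>. (norm (Q f x))\<^sup>2) \<le> (LINT x|interval_lborel \<omega>. \<omega>\<^sup>2 * (norm (f x))\<^sup>2)"
    using assms L2_Q[OF assms(1)]
    by (intro Bochner_Integration.integral_mono)
       (auto simp: L2_def Q_def norm_mult power_mult_distrib space_restrict_space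
          intro!: mult_right_mono power_mono)
  then have "sqrt (LINT x|interval_lborel \<omega>. (norm (Q f x))\<^sup>2) \<le>
      sqrt (\<omega>\<^sup>2 * (LINT x|interval_lborel \<omega>. (norm (f x))\<^sup>2))"
    by simp
  then show ?thesis
    using assms by (simp add: L2_norm_def real_sqrt_mult)
qed

lemma L2_norm_cong: "L2_eq \<omega> f g \<Longrightarrow> f \<in> L2 \<omega> \<Longrightarrow> g \<in> L2 \<omega> \<Longrightarrow> L2_norm \<omega> f = L2_norm \<omega> g"
  unfolding L2_norm_def L2_eq_def L2_def
  by (intro arg_cong[of _ _ sqrt] integral_cong_AE) auto

lemma L2_norm_eq_0D:
  assumes "f \<in> L2 \<omega>" "L2_norm \<omega> f = 0"
  shows "L2_eq \<omega> f (\<lambda>_. 0)"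
proof -
  have "AE x in interval_lborel \<omega>. (norm (f x))\<^sup>2 = 0"
    using assms by (subst integral_nonneg_eq_0_iff_AE[symmetric]) (auto simp: L2_def L2_norm_def)
  then show ?thesis by (simp add: L2_eq_def)
qed

text \<open>On a space of finite measure L^2 lies in L^1, by t \<le> 1 + t^2.\<close>

lemma L2_set_integrable:
  assumes "f \<in> L2 \<omega>"
  shows "set_integrable lborel {0<..<\<omega>} f"
proof -
  have "integrable (interval_lborel \<omega>) f"
  proof (rule Bochner_Integration.integrable_bound)
    show "integrable (interval_lborel \<omega>) (\<lambda>x. 1 + (norm (f x))\<^sup>2)"
      using assms finite_measure.integrable_const[OF finite_measure_interval_lborel, of \<omega> "1::real"]
      by (simp add: L2_def)
    have "norm (f x) \<le> norm (1 + (norm (f x))\<^sup>2)" for x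
      using sum_squares_bound[of 1 "norm (f x)"] norm_ge_zero[of "f x"]
      by (simp only: real_norm_def mult_1_right power_one)
    then show "AE x in interval_lborel \<omega>. norm (f x) \<le> norm (1 + (norm (f x))\<^sup>2)" by simp
  qed (use assms in \<open>simp add: L2_def\<close>)
  then show ?thesis by (subst set_integrable_eq) auto
qed

section \<open>Convolution with the bounded kernel x E_0(x) on L^2\<close>

definition mult_E_convolution :: "complex \<Rightarrow> operator" where
  "mult_E_convolution C f =
     (\<lambda>x. LINT y:{0<..<x}|lborel. of_real (x - y) * E C 0 (x - y) * f y)"

text \<open>A bounded kernel against an integrable function gives a bounded function, and on a
  finite interval bounded measurable functions are square integrable.\<close>

lemma mult_E_convolution_in_L2:
  assumes "\<omega> > 0" "f \<in> L2 \<omega>"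
  shows "mult_E_convolution C f \<in> L2 \<omega>"
proof -
  obtain M where M: "M \<ge> 0" "\<And>x. x \<in> {0<..\<omega>} \<Longrightarrow> norm (of_real x * E C 0 x) \<le> M"
    using mult_E_bounded[OF assms(1), of 0 C] by auto
  \<comment> \<open>The values of f off (0, \<omega>) are arbitrary; its extension by zero is Borel
    on the whole line.\<close>
  define h where "h = (\<lambda>x. indicat_real {0<..<\<omega>} x *\<^sub>R f x)"
  have h[measurable]: "h \<in> borel_measurable borel"
    using L2_measurable[OF assms(2)] by (simp add: h_def borel_measurable_interval_lborel_iff)
  have int: "integrable lborel h"
    using L2_set_integrable[OF assms(2)] by (simp add: h_def set_integrable_def)
  define K where "K = (\<lambda>x. \<integral>y. indicat_real {0<..<x} y *\<^sub>R (of_real (x - y) * E C 0 (x - y) * h y) \<partial>lborel)"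
  \<comment> \<open>With the moving interval (0, x) written as a condition, joint measurability in x
    and y can be read off.\<close>
  have "(\<lambda>x. \<integral>y. (if 0 < y \<and> y < x then of_real (x - y) * E C 0 (x - y) * h y else 0) \<partial>lborel)
      \<in> borel_measurable borel"
    by measurable
  also have "(\<lambda>x. \<integral>y. (if 0 < y \<and> y < x then of_real (x - y) * E C 0 (x - y) * h y else 0) \<partial>lborel) = K"
    unfolding K_def by (intro ext Bochner_Integration.integral_cong) auto
  finally have K: "K \<in> borel_measurable borel" .
  have eq: "mult_E_convolution C f x = K x" if "x \<in> {0<..<\<omega>}" for x
    unfolding mult_E_convolution_def K_def set_lebesgue_integral_def
    using that by (intro Bochner_Integration.integral_cong) (auto simp: h_def indicator_def)
  show ?thesis
  proof (rule bounded_in_L2)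
    have "(mult_E_convolution C f \<in> borel_measurable (interval_lborel \<omega>)) =
       (K \<in> borel_measurable (interval_lborel \<omega>))"
      by (rule measurable_cong) (auto simp: space_restrict_space eq)
    then show "mult_E_convolution C f \<in> borel_measurable (interval_lborel \<omega>)"
      using K by (simp add: measurable_restrict_space1)
    fix x assume x: "x \<in> {0<..<\<omega>}"
    have "norm (K x) \<le> (\<integral>y. M * norm (h y) \<partial>lborel)"
      unfolding K_def
    proof (rule order_trans[OF integral_norm_bound Bochner_Integration.integral_mono'])
      show "integrable lborel (\<lambda>y. M * norm (h y))" using int by simp
      show "norm (indicat_real {0<..<x} y *\<^sub>R (of_real (x - y) * E C 0 (x - y) * h y)) \<le> M * norm (h y)" for y
        using M(1) M(2)[of "x - y"] x unfolding norm_scaleR norm_mult[of _ "h y"]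
        by (cases "y \<in> {0<..<x}") (auto intro!: mult_right_mono)
    qed (use M in simp)
    then show "norm (mult_E_convolution C f x) \<le> (\<integral>y. M * norm (h y) \<partial>lborel)"
      using x by (simp add: eq)
  qed
qed

section \<open>The commutator with multiplication by the variable\<close>

text \<open>Commuting with \<open>Q\<close> multiplies the kernel E_\<beta>(x - t) by x - t. By
  \<open>E_convolution_mult_E\<close> the new kernel is \<beta> times the convolution of E_\<beta>
  with x E_0(x), and associativity splits it into two operators. The normalisation 1 /
  \<Gamma>(\<beta>) is common to both sides.\<close>

lemma V_commutator:
  assumes \<beta>: "Re \<beta> > 0" and \<omega>: "\<omega> > 0" and f: "f \<in> L2 \<omega>"
  shows "AE x in interval_lborel \<omega>.
    of_real x * V C \<beta> f x - V C \<beta> (Q f) x = \<beta> * V C \<beta> (mult_E_convolution C f) x"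
proof -
  define h where "h = (\<lambda>x. indicat_real {0<..<\<omega>} x *\<^sub>R f x)"
  have h[measurable]: "h \<in> borel_measurable borel"
    using L2_measurable[OF f] by (simp add: h_def borel_measurable_interval_lborel_iff)
  have hf: "h t = f t" if "t \<in> {0<..<\<omega>}" for t
    using that by (simp add: h_def)
  have h_int: "set_integrable lborel {0<..<\<omega>} h"
    using L2_set_integrable[OF f] by (subst set_integrable_cong[OF refl refl hf])
  obtain M where M: "\<And>x. x \<in> {0<..\<omega>} \<Longrightarrow> norm (of_real x * E C 0 x) \<le> M"
    using mult_E_bounded[OF \<omega>, of 0 C] by fastforce
  have "\<beta> \<noteq> 0" using \<beta> by auto
  have "AE x in lborel. x \<in> {0<..<\<omega>} \<longrightarrow> set_integrable lborel {0<..<x} (\<lambda>t. E C \<beta> (x - t) * h t)"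
    by (rule AE_set_integrable_convolution[OF _ _ set_integrable_E[OF \<beta> \<omega>] h_int]) measurable
  then show ?thesis
    unfolding AE_interval_lborel
  proof eventually_elim
    case (elim x)
    show ?case
    proof
      assume x: "x \<in> {0<..<\<omega>}"
      then have int: "set_integrable lborel {0<..<x} (\<lambda>t. E C \<beta> (x - t) * h t)"
        using elim by blast
      let ?c = "1 / Gamma \<beta>"
      \<comment> \<open>The two integrals may be subtracted under one integral sign only if both
        converge; |t| \<le> x reduces the second to the first.\<close>
      have intQ: "set_integrable lborel {0<..<x} (\<lambda>t. E C \<beta> (x - t) * (of_real t * h t))"
      proof (rule set_integrable_bound)
        show "set_integrable lborel {0<..<x} (\<lambda>t. of_real x * (E C \<beta> (x - t) * h t))"
          using int by (rule set_integrable_mult_right)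
        show "AE t in lborel. t \<in> {0<..<x} \<longrightarrow>
          norm (E C \<beta> (x - t) * (of_real t * h t)) \<le> norm (of_real x * (E C \<beta> (x - t) * h t))"
          by (intro AE_I2) (auto simp: norm_mult mult_ac intro!: mult_right_mono mult_left_mono)
      qed (simp add: set_borel_measurable_def)
      have "of_real x * V C \<beta> f x = ?c * (LINT t:{0<..<x}|lborel. of_real x * (E C \<beta> (x - t) * h t))"
        unfolding V_def set_integral_mult_right
        using x by (subst set_lebesgue_integral_cong[where g = "\<lambda>t. E C \<beta> (x - t) * h t"]) (auto simp: hf)
      moreover have "V C \<beta> (Q f) x = ?c * (LINT t:{0<..<x}|lborel. E C \<beta> (x - t) * (of_real t * h t))"
        unfolding V_def Q_def
        using x by (subst set_lebesgue_integral_cong[where g = "\<lambda>t. E C \<beta> (x - t) * (of_real t * h t)"]) (auto simp: hf)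
      ultimately have "of_real x * V C \<beta> f x - V C \<beta> (Q f) x =
         ?c * (LINT t:{0<..<x}|lborel. of_real x * (E C \<beta> (x - t) * h t) - E C \<beta> (x - t) * (of_real t * h t))"
        using set_integral_diff(2)[OF set_integrable_mult_right[OF int] intQ]
        by (simp add: right_diff_distrib)
      also have "(LINT t:{0<..<x}|lborel. of_real x * (E C \<beta> (x - t) * h t) - E C \<beta> (x - t) * (of_real t * h t)) =
         (LINT t:{0<..<x}|lborel. \<beta> * ((of_real (x - t) * E C \<beta> (x - t) / \<beta>) * h t))"
        using \<open>\<beta> \<noteq> 0\<close> by (intro set_lebesgue_integral_cong) (simp_all add: field_simps)
      also have "\<dots> = \<beta> * (LINT t:{0<..<x}|lborel. (of_real (x - t) * E C \<beta> (x - t) / \<beta>) * h t)"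
        by (rule set_integral_mult_right)
      \<comment> \<open>The kernel identity is read from right to left, at the point x - y.\<close>
      also have "(LINT t:{0<..<x}|lborel. (of_real (x - t) * E C \<beta> (x - t) / \<beta>) * h t) =
        (LINT y:{0<..<x}|lborel. (LINT t:{0<..<x - y}|lborel. E C \<beta> (x - y - t) * (of_real t * E C 0 t)) * h y)"
        using \<beta> by (intro set_lebesgue_integral_cong) (auto simp: E_convolution_mult_E)
      also have "\<dots> = (LINT t:{0<..<x}|lborel. E C \<beta> (x - t) *
         (LINT y:{0<..<t}|lborel. of_real (t - y) * E C 0 (t - y) * h y))"
        using x h_int \<beta>
        by (intro convolution_assoc[where M = M, symmetric] M set_integrable_E) (auto elim: set_integrable_subset)
      also have "?c * (\<beta> * \<dots>) = \<beta> * V C \<beta> (mult_E_convolution C f) x"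
      proof -
        have "(LINT y:{0<..<t}|lborel. of_real (t - y) * E C 0 (t - y) * h y) = mult_E_convolution C f t"
          if "t \<in> {0<..<x}" for t
          unfolding mult_E_convolution_def
          using that x by (intro set_lebesgue_integral_cong) (auto simp: hf)
        then have "(LINT t:{0<..<x}|lborel. E C \<beta> (x - t) *
             (LINT y:{0<..<t}|lborel. of_real (t - y) * E C 0 (t - y) * h y)) =
           (LINT t:{0<..<x}|lborel. E C \<beta> (x - t) * mult_E_convolution C f t)"
          by (intro set_lebesgue_integral_cong) auto
        then show ?thesis by (simp add: V_def)
      qed
      finally show "of_real x * V C \<beta> f x - V C \<beta> (Q f) x = \<beta> * V C \<beta> (mult_E_convolution C f) x" .
    qed
  qed
qed

text \<open>No bound on the operators uniform in \<nu> is needed: strong convergence is used at just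
  the three vectors f, Q f and K f. The defect \<open>D\<close> does not depend on \<nu>, so a bound
  tending to 0 forces its norm to be 0.\<close>

lemma V_imag_commutator:
  assumes \<omega>: "\<omega> > 0" and \<alpha>: "Re \<alpha> = 0" and T: "strong_limit \<omega> (\<lambda>\<nu>. V C (\<alpha> + of_real \<nu>)) T (at_right 0)"
    and f: "f \<in> L2 \<omega>"
  shows "L2_eq \<omega> (Q (T f)) (\<lambda>x. T (Q f) x + \<alpha> * T (mult_E_convolution C f) x)"
proof -
  let ?K = "mult_E_convolution C f"
  let ?V = "\<lambda>\<nu>::real. V C (\<alpha> + of_real \<nu>)"
  define D where "D = (\<lambda>x. Q (T f) x - T (Q f) x - \<alpha> * T ?K x)"
  define R where "R g \<nu> = (\<lambda>x. ?V \<nu> g x - T g x)" for g \<nu>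
  note K = mult_E_convolution_in_L2[OF \<omega> f, of C] and Qf = L2_Q[OF f]
  have TL2: "T g \<in> L2 \<omega>" if "g \<in> L2 \<omega>" for g
    using T that by (auto simp: strong_limit_def)
  have ev: "\<forall>\<^sub>F \<nu> in at_right 0. ?V \<nu> g \<in> L2 \<omega>" if "g \<in> L2 \<omega>" for g
    using T that by (auto simp: strong_limit_def)
  have lim: "((\<lambda>\<nu>. L2_norm \<omega> (R g \<nu>)) \<longlongrightarrow> 0) (at_right 0)" if "g \<in> L2 \<omega>" for g
    using T that by (auto simp: strong_limit_def R_def)
  have D: "D \<in> L2 \<omega>"
    unfolding D_def using f K Qf by (intro L2_diff L2_cmult TL2 L2_Q)
  \<comment> \<open>One term for each of the three approximation errors, and a fourth because the
    commutator at \<alpha> + \<nu> carries the coefficient \<alpha> + \<nu> instead of \<alpha>. The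
    factor 4 comes from applying the two-term inequality twice.\<close>
  define B where "B \<nu> = 4 * (\<omega> * L2_norm \<omega> (R f \<nu>))\<^sup>2 + 4 * (L2_norm \<omega> (R (Q f) \<nu>))\<^sup>2
     + 4 * (norm (\<alpha> + of_real \<nu>) * L2_norm \<omega> (R ?K \<nu>))\<^sup>2 + 4 * (norm (complex_of_real \<nu>) * L2_norm \<omega> (T ?K))\<^sup>2" for \<nu>
  have "((\<lambda>\<nu>. norm (\<alpha> + complex_of_real \<nu>)) \<longlongrightarrow> norm (\<alpha> + of_real 0)) (at_right 0)"
    "((\<lambda>\<nu>. norm (complex_of_real \<nu>)) \<longlongrightarrow> norm (of_real 0 :: complex)) (at_right 0)"
    by (intro tendsto_intros)+
  then have "(B \<longlongrightarrow> 4 * (\<omega> * 0)\<^sup>2 + 4 * 0\<^sup>2 + 4 * (norm (\<alpha> + of_real 0) * 0)\<^sup>2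
      + 4 * (norm (of_real 0 :: complex) * L2_norm \<omega> (T ?K))\<^sup>2) (at_right 0)"
    unfolding B_def by (intro tendsto_intros lim f K Qf)
  then have B: "(B \<longlongrightarrow> 0) (at_right 0)" by simp
  have "\<forall>\<^sub>F \<nu> in at_right 0. (L2_norm \<omega> D)\<^sup>2 \<le> B \<nu>"
    using ev[OF f] ev[OF Qf] ev[OF K] eventually_at_right_less[of "0::real"]
  proof eventually_elim
    case (elim \<nu>)
    let ?\<beta> = "\<alpha> + of_real \<nu>"
    have R: "R f \<nu> \<in> L2 \<omega>" "R (Q f) \<nu> \<in> L2 \<omega>" "R ?K \<nu> \<in> L2 \<omega>"
      using elim f K Qf by (auto simp: R_def intro!: L2_diff TL2)
    \<comment> \<open>With \<beta> = \<alpha> + \<nu>, the commutator of \<open>V\<close> gives D =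
      - Q R(f) + R(Q f) + \<beta> R(K f) + \<nu> T(K f) almost everywhere, where R is the error of
      the approximation.\<close>
    define a where "a = (\<lambda>x. (-1) * Q (R f \<nu>) x)"
    define c where "c = (\<lambda>x. ?\<beta> * R ?K \<nu> x)"
    define d where "d = (\<lambda>x. of_real \<nu> * T ?K x)"
    have L2s: "a \<in> L2 \<omega>" "c \<in> L2 \<omega>" "d \<in> L2 \<omega>" "(\<lambda>x. a x + R (Q f) \<nu> x) \<in> L2 \<omega>" "(\<lambda>x. c x + d x) \<in> L2 \<omega>"
      unfolding a_def c_def d_def by - (intro L2_cmult L2_Q TL2 L2_add R K)+
    have "AE x in interval_lborel \<omega>. of_real x * ?V \<nu> f x - ?V \<nu> (Q f) x = ?\<beta> * ?V \<nu> ?K x"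
      using elim \<alpha> by (intro V_commutator \<omega> f) auto
    then have "L2_eq \<omega> D (\<lambda>x. (a x + R (Q f) \<nu> x) + (c x + d x))"
      unfolding L2_eq_def
    proof eventually_elim
      case (elim x)
      then show ?case
        by (simp add: D_def a_def c_def d_def R_def Q_def algebra_simps)
    qed
    then have "(L2_norm \<omega> D)\<^sup>2 = (L2_norm \<omega> (\<lambda>x. (a x + R (Q f) \<nu> x) + (c x + d x)))\<^sup>2"
      using L2s D by (subst L2_norm_cong) (auto intro: L2_add)
    also have "\<dots> \<le> 2 * (L2_norm \<omega> (\<lambda>x. a x + R (Q f) \<nu> x))\<^sup>2 + 2 * (L2_norm \<omega> (\<lambda>x. c x + d x))\<^sup>2"
      using L2s by (intro L2_norm_add_power2_le)
    also have "\<dots> \<le> 4 * (L2_norm \<omega> a)\<^sup>2 + 4 * (L2_norm \<omega> (R (Q f) \<nu>))\<^sup>2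
        + 4 * (L2_norm \<omega> c)\<^sup>2 + 4 * (L2_norm \<omega> d)\<^sup>2"
      using L2_norm_add_power2_le[OF L2s(1) R(2)] L2_norm_add_power2_le[OF L2s(2,3)] by simp
    also have "(L2_norm \<omega> a)\<^sup>2 \<le> (\<omega> * L2_norm \<omega> (R f \<nu>))\<^sup>2"
      unfolding a_def L2_norm_cmult using L2_norm_Q_le[OF R(1) \<omega>]
      by (intro power_mono) (auto simp: L2_norm_nonneg)
    finally show "(L2_norm \<omega> D)\<^sup>2 \<le> B \<nu>"
      unfolding B_def c_def d_def L2_norm_cmult by simp
  qed
  from tendsto_lowerbound[OF B this] have "L2_norm \<omega> D = 0"
    by simp
  with D have "L2_eq \<omega> D (\<lambda>_. 0)"
    by (rule L2_norm_eq_0D)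
  then show ?thesis
    unfolding L2_eq_def D_def by eventually_elim (simp add: algebra_simps)
qed

section \<open>Operators on classes of functions, and inversion of V_\<alpha>\<close>

lemma bounded_operator_add:
  "bounded_operator \<omega> T \<Longrightarrow> f \<in> L2 \<omega> \<Longrightarrow> g \<in> L2 \<omega> \<Longrightarrow>
    L2_eq \<omega> (T (\<lambda>x. f x + g x)) (\<lambda>x. T f x + T g x)"
  by (simp add: bounded_operator_def)

lemma bounded_operator_cmult:
  "bounded_operator \<omega> T \<Longrightarrow> f \<in> L2 \<omega> \<Longrightarrow> L2_eq \<omega> (T (\<lambda>x. c * f x)) (\<lambda>x. c * T f x)"
  by (simp add: bounded_operator_def)

text \<open>The commutator identity holds only almost everywhere, yet the inverse has to be applied
  to both of its sides. Additivity and homogeneity reduce this to the difference f - g, whose norm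
  is 0, and boundedness sends it to a function of norm 0.\<close>

lemma bounded_operator_cong:
  assumes T: "bounded_operator \<omega> T" and f: "f \<in> L2 \<omega>" and g: "g \<in> L2 \<omega>" and eq: "L2_eq \<omega> f g"
  shows "L2_eq \<omega> (T f) (T g)"
proof -
  let ?m = "\<lambda>x. (-1) * g x"
  have m: "?m \<in> L2 \<omega>" by (rule L2_cmult[OF g])
  then have d: "(\<lambda>x. f x + ?m x) \<in> L2 \<omega>" by (rule L2_add[OF f])
  obtain k where k: "\<And>h. h \<in> L2 \<omega> \<Longrightarrow> L2_norm \<omega> (T h) \<le> k * L2_norm \<omega> h"
    using T unfolding bounded_operator_def by blast
  have "AE x in interval_lborel \<omega>. (norm (f x + ?m x))\<^sup>2 = 0"
    using eq unfolding L2_eq_def by eventually_elim simp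
  then have "L2_norm \<omega> (\<lambda>x. f x + ?m x) = 0"
    unfolding L2_norm_def by (simp add: integral_eq_zero_AE)
  then have "L2_norm \<omega> (T (\<lambda>x. f x + ?m x)) = 0"
    using k[OF d] L2_norm_nonneg[of \<omega> "T (\<lambda>x. f x + ?m x)"] by simp
  then have "L2_eq \<omega> (T (\<lambda>x. f x + ?m x)) (\<lambda>_. 0)"
    using T d by (intro L2_norm_eq_0D) (auto simp: bounded_operator_def)
  moreover have "L2_eq \<omega> (T (\<lambda>x. f x + ?m x)) (\<lambda>x. T f x + T ?m x)"
    by (rule bounded_operator_add[OF T f m])
  moreover have "L2_eq \<omega> (T ?m) (\<lambda>x. (-1) * T g x)"
    by (rule bounded_operator_cmult[OF T g])
  ultimately show ?thesis
    unfolding L2_eq_def by eventually_elim (simp add: add_eq_0_iff2)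
qed

theorem theorem3p4:
  fixes \<omega> :: real and C \<alpha> :: complex and V\<alpha> V\<alpha>_inv A\<alpha> :: operator
  assumes "0 < \<omega>" and "Re \<alpha> = 0" and "\<alpha> \<noteq> 0"
    and "is_V_imag \<omega> C \<alpha> V\<alpha>"
    and "bounded_inverse \<omega> V\<alpha> V\<alpha>_inv"
    and "A\<alpha> = V\<alpha>_inv \<circ> Q \<circ> V\<alpha>"
  shows "\<forall>f\<in>L2 \<omega>. L2_eq \<omega> (A\<alpha> f)
           (\<lambda>x. of_real x * f x
              + \<alpha> * (LINT y:{0<..<x}|lborel. of_real (x - y) * E C 0 (x - y) * f y))"
proof
  fix f assume f: "f \<in> L2 \<omega>"
  let ?K = "mult_E_convolution C f"
  let ?aK = "\<lambda>x. \<alpha> * ?K x"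
  \<comment> \<open>The claimed value of \<open>A\<alpha> f\<close>. It is enough that
    \<open>V\<alpha>\<close> maps it to \<open>Q (V\<alpha> f)\<close> almost everywhere, since
    \<open>V\<alpha>_inv\<close> then returns it.\<close>
  let ?g = "\<lambda>x. Q f x + ?aK x"
  have V: "bounded_operator \<omega> V\<alpha>" "strong_limit \<omega> (\<lambda>\<nu>. V C (\<alpha> + of_real \<nu>)) V\<alpha> (at_right 0)"
    using assms by (auto simp: is_V_imag_def)
  have inv: "bounded_operator \<omega> V\<alpha>_inv" "\<And>h. h \<in> L2 \<omega> \<Longrightarrow> L2_eq \<omega> (V\<alpha>_inv (V\<alpha> h)) h"
    using assms by (auto simp: bounded_inverse_def)
  have VL2: "V\<alpha> h \<in> L2 \<omega>" if "h \<in> L2 \<omega>" for h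
    using V(1) that by (auto simp: bounded_operator_def)
  note Qf = L2_Q[OF f] and K = mult_E_convolution_in_L2[OF assms(1) f, of C]
  note aK = L2_cmult[OF K, of \<alpha>]
  have g: "?g \<in> L2 \<omega>" by (rule L2_add[OF Qf aK])
  have "L2_eq \<omega> (V\<alpha> ?g) (\<lambda>x. V\<alpha> (Q f) x + V\<alpha> ?aK x)"
    by (rule bounded_operator_add[OF V(1) Qf aK])
  moreover have "L2_eq \<omega> (V\<alpha> ?aK) (\<lambda>x. \<alpha> * V\<alpha> ?K x)"
    by (rule bounded_operator_cmult[OF V(1) K])
  moreover have "L2_eq \<omega> (Q (V\<alpha> f)) (\<lambda>x. V\<alpha> (Q f) x + \<alpha> * V\<alpha> ?K x)"
    using V_imag_commutator[OF assms(1,2) V(2) f] .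
  ultimately have "L2_eq \<omega> (Q (V\<alpha> f)) (V\<alpha> ?g)"
    unfolding L2_eq_def by eventually_elim simp
  then have "L2_eq \<omega> (V\<alpha>_inv (Q (V\<alpha> f))) (V\<alpha>_inv (V\<alpha> ?g))"
    by (intro bounded_operator_cong[OF inv(1)] L2_Q VL2 f g)
  moreover note inv(2)[OF g]
  ultimately have "L2_eq \<omega> (A\<alpha> f) ?g"
    unfolding L2_eq_def assms(6) by eventually_elim simp
  then show "L2_eq \<omega> (A\<alpha> f) (\<lambda>x. of_real x * f x
              + \<alpha> * (LINT y:{0<..<x}|lborel. of_real (x - y) * E C 0 (x - y) * f y))"
    by (simp add: Q_def mult_E_convolution_def)
qed

end
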